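(* Let $n,m\in\mathbb{Z}_{>0}$, $A\in\mathbb{R}^{n\times n}$, $B\in\mathbb{R}^{n\times m}$ with $(A,B)$ stabilizable, and let $Q\in\mathbb{R}^{n\times n}$, $R\in\mathbb{R}^{m\times m}$ be symmetric with $Q\succ 0$ and $R\succ 0$. Let $\gamma\in[0,1]$ and $K_0\in\mathcal{K}_1$. The algorithm sPI (described in the context), initialized at $K_0$, satisfies the following properties. (i) (Recursive feasibility) For any $j\in\mathbb{Z}_{>0}$, given the pair $(K_{j-1},P_{j-1})$ generated by the algorithm at the previous step, there always exist $\alpha_j\in(0,1]$, $K_j\in\mathcal{K}_1$ and a symmetric matrix $P_j$ such that $$K_j=\alpha_j\left(-\gamma(R+\gamma B^\top P_{j-1}B)^{-1}B^\top P_{j-1}A\right)+(1-\alpha_j)K_{j-1}$$ and $$\sqrt{\gamma}(A+BK_j)^\top P_j\sqrt{\gamma}(A+BK_j)-P_j+K_j^\top RK_j+Q=0.$$ (ii) (Recursive cost improvement) For any sequence generated by the algorithm and any $j\in\mathbb{Z}_{>0}$, $P_j\preceq P_{j-1}$, implying that $J_\gamma(x_0,K_j)-J_\gamma(x_0,K_{j-1})\le0$ for any $x_0\in\mathbb{R}^n$.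
   Context: $\rho(M)$ denotes the spectral radius of a square matrix $M$; $\succ0$ (resp. $\succeq 0$) means symmetric positive definite (resp. semidefinite), and $M\preceq N$ means $N-M\succeq0$. $(A,B)$ stabilizable means there is $K\in\mathbb{R}^{m\times n}$ with $\rho(A+BK)<1$. $\mathcal{K}_1:=\{K\in\mathbb{R}^{m\times n}:\rho(A+BK)<1\}$. For $K\in\mathbb{R}^{m\times n}$, $J_\gamma(x_0,K):=\sum_{k=0}^\infty\gamma^k\,(x_k^\top Qx_k+u_k^\top Ru_k)$, where $x_{k+1}=Ax_k+Bu_k$, $u_k=Kx_k$ for all $k\ge0$, with initial state $x_0$ (convention $0^0=1$). Algorithm sPI. Input: $K_0\in\mathcal{K}_1$, $\gamma\in[0,1]$, $A,B,Q,R$. Initial evaluation step: let $P_0$ be the solution of $\sqrt{\gamma}(A+BK_0)^\top P_0\sqrt{\gamma}(A+BK_0)-P_0+K_0^\top RK_0+Q=0$. For each $j=1,2,\dots$: Improvement step: select any $\alpha_j\in(0,1]$ such that $K_j\in\mathcal{K}_1$, where $K_j=\alpha_j\left(-\gamma(R+\gamma B^\top P_{j-1}B)^{-1}B^\top P_{j-1}A\right)+(1-\alpha_j)K_{j-1}$. Evaluation step: let $P_j$ be the solution of $\sqrt{\gamma}(A+BK_j)^\top P_j\sqrt{\gamma}(A+BK_j)-P_j+K_j^\top RK_j+Q=0$. (For $K_j\in\mathcal{K}_1$ this Lyapunov equation has a unique solution, which is symmetric positive definite.) *)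

theory Defs
  imports "HOL-Analysis.Analysis"
begin

text \<open>An \<open>r \<times> c\<close> real matrix has type \<open>real^'c^'r\<close>; thus \<open>A :: real^'n^'n\<close>,
  \<open>B :: real^'m^'n\<close> and \<open>K :: real^'n^'m\<close>. The eigenvalues of a real matrix are those of
  its complexification.\<close>

definition complexify :: "real^'c^'r \<Rightarrow> complex^'c^'r" where
  "complexify M = (\<chi> i j. complex_of_real (M $ i $ j))"

definition complex_eigenvalues :: "real^'n^'n \<Rightarrow> complex set" where
  "complex_eigenvalues M = {l. \<exists>v. v \<noteq> 0 \<and> complexify M *v v = l *s v}"

definition spec_radius :: "real^'n^'n \<Rightarrow> real" where
  "spec_radius M = Max (cmod ` complex_eigenvalues M)"

definition symmetric_matrix :: "real^'n^'n \<Rightarrow> bool" where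
  "symmetric_matrix M \<longleftrightarrow> transpose M = M"

definition pos_def :: "real^'n^'n \<Rightarrow> bool" where
  "pos_def M \<longleftrightarrow> symmetric_matrix M \<and> (\<forall>x. x \<noteq> 0 \<longrightarrow> 0 < x \<bullet> (M *v x))"

definition pos_semidef :: "real^'n^'n \<Rightarrow> bool" where
  "pos_semidef M \<longleftrightarrow> symmetric_matrix M \<and> (\<forall>x. 0 \<le> x \<bullet> (M *v x))"

definition loewner_le :: "real^'n^'n \<Rightarrow> real^'n^'n \<Rightarrow> bool" where
  "loewner_le M N \<longleftrightarrow> pos_semidef (N - M)"

definition stabilizing_gains :: "real^'n^'n \<Rightarrow> real^'m^'n \<Rightarrow> (real^'n^'m) set" where
  "stabilizing_gains A B = {K. spec_radius (A + B ** K) < 1}"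

definition stabilizable :: "real^'n^'n \<Rightarrow> real^'m^'n \<Rightarrow> bool" where
  "stabilizable A B \<longleftrightarrow> (\<exists>K. spec_radius (A + B ** K) < 1)"

primrec closed_loop_state ::
  "real^'n^'n \<Rightarrow> real^'m^'n \<Rightarrow> real^'n^'m \<Rightarrow> real^'n \<Rightarrow> nat \<Rightarrow> real^'n" where
  "closed_loop_state A B K x0 0 = x0"
| "closed_loop_state A B K x0 (Suc k) =
     A *v closed_loop_state A B K x0 k + B *v (K *v closed_loop_state A B K x0 k)"

definition discounted_cost ::
  "real^'n^'n \<Rightarrow> real^'m^'n \<Rightarrow> real^'n^'n \<Rightarrow> real^'m^'m \<Rightarrow> real \<Rightarrow> real^'n \<Rightarrow> real^'n^'m \<Rightarrow> real" where
  "discounted_cost A B Q R \<gamma> x0 K =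
     (\<Sum>k. \<gamma> ^ k *
        (let x = closed_loop_state A B K x0 k; u = K *v x
         in x \<bullet> (Q *v x) + u \<bullet> (R *v u)))"

definition lyapunov_solution ::
  "real^'n^'n \<Rightarrow> real^'m^'n \<Rightarrow> real^'n^'n \<Rightarrow> real^'m^'m \<Rightarrow> real \<Rightarrow> real^'n^'m \<Rightarrow> real^'n^'n \<Rightarrow> bool" where
  "lyapunov_solution A B Q R \<gamma> K P \<longleftrightarrow>
     (sqrt \<gamma> *\<^sub>R transpose (A + B ** K)) ** P ** (sqrt \<gamma> *\<^sub>R (A + B ** K))
       - P + transpose K ** R ** K + Q = 0"

definition improved_gain ::
  "real^'n^'n \<Rightarrow> real^'m^'n \<Rightarrow> real^'m^'m \<Rightarrow> real \<Rightarrow> real^'n^'n \<Rightarrow> real \<Rightarrow> real^'n^'m \<Rightarrow> real^'n^'m" where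
  "improved_gain A B R \<gamma> P \<alpha> K =
     \<alpha> *\<^sub>R (- (\<gamma> *\<^sub>R (matrix_inv (R + \<gamma> *\<^sub>R (transpose B ** P ** B)) ** transpose B ** P ** A)))
       + (1 - \<alpha>) *\<^sub>R K"

text \<open>\<open>sPI_run A B Q R \<gamma> K0 N \<alpha> K P\<close>: the first entries \<open>\<alpha> 1, \<dots>, \<alpha> N\<close>,
  \<open>K 0, \<dots>, K N\<close>, \<open>P 0, \<dots>, P N\<close> are a possible outcome of \<open>N\<close> iterations started at \<open>K0\<close>;
  later entries (and \<open>\<alpha> 0\<close>) are unconstrained.\<close>

definition sPI_run ::
  "real^'n^'n \<Rightarrow> real^'m^'n \<Rightarrow> real^'n^'n \<Rightarrow> real^'m^'m \<Rightarrow> real \<Rightarrow> real^'n^'m \<Rightarrow> nat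
    \<Rightarrow> (nat \<Rightarrow> real) \<Rightarrow> (nat \<Rightarrow> real^'n^'m) \<Rightarrow> (nat \<Rightarrow> real^'n^'n) \<Rightarrow> bool" where
  "sPI_run A B Q R \<gamma> K0 N \<alpha> K P \<longleftrightarrow>
     K 0 = K0 \<and> lyapunov_solution A B Q R \<gamma> (K 0) (P 0) \<and>
     (\<forall>j\<in>{1..N}.
        \<alpha> j \<in> {0<..1} \<and>
        K j = improved_gain A B R \<gamma> (P (j - 1)) (\<alpha> j) (K (j - 1)) \<and>
        K j \<in> stabilizing_gains A B \<and>
        lyapunov_solution A B Q R \<gamma> (K j) (P j))"

end

theory Submission
  imports Defs "HOL-Computational_Algebra.Fundamental_Theorem_Algebra"
begin

text \<open>Write \<open>F\<close> for the discounted closed-loop matrix \<open>\<surd>\<gamma> (A + B K)\<close>. Stability enters only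
  through the convergence \<open>F\<^sup>k x \<longrightarrow> 0\<close>, obtained from \<open>\<rho>(F) < 1\<close> by splitting an annihilating
  polynomial into linear factors. It makes \<open>X \<mapsto> X - F\<^sup>T X F\<close> injective, hence bijective, so the
  Stein equation \<open>F\<^sup>T P F + W = P\<close> has a unique solution, and telescoping gives
  \<open>x\<^sup>T P x = \<Sum>\<^sub>k (F\<^sup>k x)\<^sup>T W (F\<^sup>k x)\<close>. So \<open>P\<close> inherits definiteness from \<open>W\<close> and, when \<open>W\<close> is the
  stage cost, represents the discounted cost.

  Feasibility: conversely, \<open>P \<succ> 0\<close> and \<open>P - F\<^sup>T P F \<succ> 0\<close> force \<open>\<rho>(F) < 1\<close>. Positive definiteness
  is an open condition, hence so is stability, and the improved gain tends to \<open>K\<close> as \<open>\<alpha> \<down> 0\<close>.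

  Improvement: completing the square shows that a step towards the greedy gain does not increase
  the one-step cost-to-go with terminal form \<open>P\<^bsub>j-1\<^esub>\<close>. So \<open>P\<^bsub>j-1\<^esub>\<close> is a supersolution of the
  Stein equation of \<open>K\<^bsub>j\<^esub>\<close>, and supersolutions dominate the solution \<open>P\<^bsub>j\<^esub>\<close>.\<close>

section \<open>Matrix polynomials and eigenvalues\<close>

lemma matrix_add_rdistrib: "(A + B) ** C = A ** C + B ** (C :: 'a::semiring_1^'n^'m)"
  by (simp add: matrix_matrix_mult_def vec_eq_iff distrib_right sum.distrib)

lemma mat_add: "mat (a + b) = mat a + (mat b :: 'a::comm_semiring_1^'n^'n)"
  by (simp add: mat_def vec_eq_iff)

lemma mat_mult_component: "(mat c ** M) $ i $ j = c * M $ i $ j"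
  by (simp add: matrix_matrix_mult_def mat_def if_distrib if_distribR cong: if_cong)

lemma mat_mult_commute:
  fixes M :: "'a::comm_semiring_1^'n^'n"
  shows "M ** mat c = mat c ** M"
  by (simp add: vec_eq_iff mat_mult_component)
    (simp add: matrix_matrix_mult_def mat_def if_distrib mult.commute cong: if_cong)

lemma mat_mult_mat: "mat c ** mat d = (mat (c * d) :: 'a::comm_semiring_1^'n^'n)"
  by (simp add: vec_eq_iff mat_mult_component) (simp add: mat_def)

lemma mat_mult_vector: "mat c *v v = (c::'a::comm_semiring_1) *s v"
  by (simp add: vec_eq_iff matrix_vector_mult_def mat_def if_distrib if_distribR cong: if_cong)

definition matrix_poly :: "'a::comm_ring_1 poly \<Rightarrow> 'a^'n^'n \<Rightarrow> 'a^'n^'n" where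
  "matrix_poly p M = fold_coeffs (\<lambda>a X. mat a + M ** X) p 0"

lemma matrix_poly_0 [simp]: "matrix_poly 0 M = 0"
  by (simp add: matrix_poly_def)

lemma matrix_poly_pCons [simp]: "matrix_poly (pCons a p) M = mat a + M ** matrix_poly p M"
  by (cases "p = 0 \<and> a = 0") (auto simp: matrix_poly_def)

lemma matrix_poly_add: "matrix_poly (p + q) M = matrix_poly p M + matrix_poly q M"
proof (induction p arbitrary: q)
  case (pCons a p)
  obtain b r where "q = pCons b r" by (cases q)
  then show ?case
    using pCons.IH[of r] by (simp add: mat_add matrix_add_ldistrib)
qed simp

lemma matrix_poly_smult: "matrix_poly (smult c p) M = mat c ** matrix_poly p M"
proof (induction p)
  case (pCons a p)
  have "M ** (mat c ** matrix_poly p M) = mat c ** (M ** matrix_poly p M)"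
    by (simp only: matrix_mul_assoc mat_mult_commute)
  then show ?case
    by (simp add: pCons.IH mat_mult_mat matrix_add_ldistrib)
qed simp

lemma matrix_poly_sum: "matrix_poly (\<Sum>i\<in>I. p i) M = (\<Sum>i\<in>I. matrix_poly (p i) M)"
  by (induction I rule: infinite_finite_induct) (simp_all add: matrix_poly_add)

lemma matrix_poly_mult: "matrix_poly (p * q) M = matrix_poly p M ** matrix_poly q M"
  by (induction p)
    (simp_all add: matrix_poly_add matrix_poly_smult matrix_add_rdistrib flip: matrix_mul_assoc)

lemma matrix_poly_linear_factor: "matrix_poly [:- l, 1:] M *v v = M *v v - l *s v"
  by (simp add: matrix_vector_mult_add_rdistrib mat_mult_vector vec_eq_iff)

lemma matrix_poly_linear_factor_mult:
  "matrix_poly ([:- l, 1:] * q) M *v v = M *v (matrix_poly q M *v v) - l *s (matrix_poly q M *v v)"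
  unfolding matrix_poly_mult matrix_vector_mul_assoc[symmetric] matrix_poly_linear_factor ..

lemma matrix_poly_mult_linear_factor:
  "matrix_poly ([:- l, 1:] * q) M *v v = matrix_poly q M *v (M *v v - l *s v)"
  unfolding mult.commute[of _ q] matrix_poly_mult matrix_vector_mul_assoc[symmetric]
    matrix_poly_linear_factor ..

lemma matrix_poly_eigenvector:
  fixes M :: "'a::field^'n^'n"
  assumes "M *v v = l *s v"
  shows "matrix_poly p M *v v = poly p l *s v"
proof (induction p)
  case (pCons a p)
  have "matrix_poly (pCons a p) M *v v = a *s v + M *v (poly p l *s v)"
    by (simp add: matrix_vector_mult_add_rdistrib mat_mult_vector pCons.IH flip: matrix_vector_mul_assoc)
  also have "\<dots> = poly (pCons a p) l *s v"
    by (simp add: vec.scale assms vec.scale_left_distrib mult.commute)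
  finally show ?case .
qed simp

lemma (in finite_dimensional_vector_space) nontrivial_relation_of_family:
  fixes f :: "'i \<Rightarrow> 'b"
  assumes "finite I" and card: "dim (UNIV :: 'b set) < card I"
  obtains c i where "i \<in> I" "c i \<noteq> 0" "(\<Sum>i\<in>I. c i *s f i) = 0"
proof (cases "inj_on f I")
  case True
  then have "dim (f ` I) < card (f ` I)"
    using card dim_subset[of "f ` I" UNIV] by (simp add: card_image)
  then have "dependent (f ` I)"
    using independent_card_le_dim by fastforce
  then obtain u w where "w \<in> f ` I" "u w \<noteq> 0" "(\<Sum>w\<in>f ` I. u w *s w) = 0"
    using \<open>finite I\<close> by (auto simp: dependent_finite)
  then show ?thesis
    using True that[of _ "u \<circ> f"] by (auto simp: sum.reindex)
next
  case False
  then obtain i j where ij: "i \<in> I" "j \<in> I" "i \<noteq> j" "f i = f j"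
    by (auto simp: inj_on_def)
  define c :: "'i \<Rightarrow> 'a" where "c k = (if k = i then 1 else 0) - (if k = j then 1 else 0)" for k
  have "(\<Sum>k\<in>I. c k *s f k) = (\<Sum>k\<in>I. (if k = i then f k else 0)) - (\<Sum>k\<in>I. (if k = j then f k else 0))"
    unfolding sum_subtractf[symmetric] by (intro sum.cong) (auto simp: c_def)
  also have "\<dots> = 0"
    using \<open>finite I\<close> ij by simp
  finally show ?thesis
    using ij that[of i c] by (simp add: c_def)
qed

lemma annihilating_matrix_poly_exists:
  fixes M :: "'a::field^'n^'n"
  obtains p where "p \<noteq> 0" "matrix_poly p M = 0"
proof -
  define pow where "pow i = matrix_poly (monom 1 i) M" for i
  \<comment> \<open>Matrices carry no scalar multiplication by \<open>'a\<close>, but vectors with \<open>n\<^sup>2\<close> entries do.\<close>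
  define flat where "flat X = (\<chi> p. X $ fst p $ snd p)" for X :: "'a^'n^'n"
  define N where "N = vec.dim (UNIV :: ('a^('n \<times> 'n)) set)"
  obtain c i where "i \<le> N" "c i \<noteq> 0" and relation: "(\<Sum>i\<le>N. c i *s flat (pow i)) = 0"
    by (rule vec.nontrivial_relation_of_family[of "{..N}" "\<lambda>i. flat (pow i)"]) (auto simp: N_def)
  define p where "p = (\<Sum>i\<le>N. smult (c i) (monom 1 i))"
  have "coeff p i = c i"
    using \<open>i \<le> N\<close> by (simp add: p_def coeff_sum if_distrib cong: if_cong)
  then have "p \<noteq> 0"
    using \<open>c i \<noteq> 0\<close> by auto
  moreover have "matrix_poly p M $ r $ s = (\<Sum>i\<le>N. c i *s flat (pow i)) $ (r, s)" for r s
    by (simp add: p_def matrix_poly_sum matrix_poly_smult mat_mult_component pow_def flat_def)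
  then have "matrix_poly p M = 0"
    by (simp add: relation vec_eq_iff)
  ultimately show ?thesis ..
qed

definition eigenvalues :: "'a::field^'n^'n \<Rightarrow> 'a set" where
  "eigenvalues M = {l. \<exists>v. v \<noteq> 0 \<and> M *v v = l *s v}"

lemma finite_eigenvalues: "finite (eigenvalues M)"
proof -
  obtain p where "p \<noteq> 0" "matrix_poly p M = 0"
    by (rule annihilating_matrix_poly_exists)
  then have "eigenvalues M \<subseteq> {l. poly p l = 0}"
    using matrix_poly_eigenvector[of M _ _ p] by (auto simp: eigenvalues_def)
  then show ?thesis
    using poly_roots_finite[OF \<open>p \<noteq> 0\<close>] finite_subset by blast
qed

text \<open>Split a root \<open>l\<close> off a polynomial annihilating \<open>v\<close>, leaving the cofactor \<open>q\<close>. Either \<open>q\<close>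
  already annihilates \<open>v\<close>, or \<open>q\<close> maps \<open>v\<close> to an eigenvector for \<open>l\<close> and annihilates
  \<open>M *v v - l *s v\<close>.\<close>

lemma eigenvalue_induct [case_names zero eigenvalue]:
  fixes M :: "'a::alg_closed_field^'n^'n"
  assumes zero: "P 0"
    and eigenvalue: "\<And>l v. l \<in> eigenvalues M \<Longrightarrow> P (M *v v - l *s v) \<Longrightarrow> P v"
  shows "P v"
proof -
  obtain p where "p \<noteq> 0" "matrix_poly p M *v v = 0"
    using annihilating_matrix_poly_exists[of M] by (metis matrix_vector_mult_0)
  then show ?thesis
  proof (induction "degree p" arbitrary: p v)
    case 0
    then obtain a where "p = [:a:]" "a \<noteq> 0"
      by (metis degree_eq_zeroE pCons_0_0)
    with 0 have "v = 0"
      by (simp add: mat_mult_vector)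
    then show ?case using zero by simp
  next
    case (Suc d)
    then obtain l where "poly p l = 0"
      using alg_closed_imp_poly_has_root[of p] by auto
    then obtain q where p: "p = [:- l, 1:] * q"
      by (auto simp: poly_eq_0_iff_dvd)
    have "q \<noteq> 0"
      using p Suc.prems(1) by auto
    then have degree: "d = degree q"
      using Suc.hyps(2) unfolding p by (subst (asm) degree_mult_eq) auto
    have eigenvector: "M *v (matrix_poly q M *v v) = l *s (matrix_poly q M *v v)"
      using Suc.prems(2) by (simp add: p matrix_poly_linear_factor_mult del: mult_pCons_left)
    have annihilates: "matrix_poly q M *v (M *v v - l *s v) = 0"
      using Suc.prems(2) by (simp add: p matrix_poly_mult_linear_factor del: mult_pCons_left)
    show ?case
    proof (cases "matrix_poly q M *v v = 0")
      case True
      then show ?thesis using Suc.hyps(1)[OF degree \<open>q \<noteq> 0\<close>] by blast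
    next
      case False
      then have "l \<in> eigenvalues M"
        using eigenvector by (auto simp: eigenvalues_def)
      then show ?thesis
        using Suc.hyps(1)[OF degree \<open>q \<noteq> 0\<close> annihilates] by (rule eigenvalue)
    qed
  qed
qed

lemma eigenvalues_nonempty:
  fixes M :: "'a::alg_closed_field^'n^'n"
  shows "eigenvalues M \<noteq> {}"
proof
  assume "eigenvalues M = {}"
  then have "v = 0" for v :: "'a^'n"
    using eigenvalue_induct[of "\<lambda>v. v = 0" M] by blast
  then have "axis undefined 1 = (0 :: 'a^'n)" by blast
  then show False by (simp add: axis_eq_0_iff)
qed

lemma spec_radius_less_iff:
  "spec_radius M < r \<longleftrightarrow> (\<forall>l\<in>eigenvalues (complexify M). cmod l < r)"
proof -
  have "spec_radius M = Max (cmod ` eigenvalues (complexify M))"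
    by (simp add: spec_radius_def complex_eigenvalues_def eigenvalues_def)
  then show ?thesis
    by (simp add: finite_eigenvalues eigenvalues_nonempty)
qed

section \<open>Vanishing powers\<close>

lemma tendsto_0_contractive_recurrence:
  fixes x b :: "nat \<Rightarrow> real"
  assumes r: "0 \<le> r" "r < 1" and nonneg: "\<And>k. 0 \<le> x k"
    and recurrence: "\<And>k. x (Suc k) \<le> r * x k + b k" and b: "b \<longlonglongrightarrow> 0"
  shows "x \<longlonglongrightarrow> 0"
proof (rule order_tendstoI)
  fix e :: real assume "0 < e"
  then have "0 < (1 - r) * (e / 2)"
    using r by simp
  then obtain N where b_less: "\<And>k. k \<ge> N \<Longrightarrow> b k < (1 - r) * (e / 2)"
    using order_tendstoD(2)[OF b] unfolding eventually_sequentially by blast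
  have bound: "x (k + N) \<le> e / 2 + r ^ k * x N" for k
  proof (induction k)
    case (Suc k)
    have "x (Suc k + N) \<le> r * x (k + N) + b (k + N)"
      using recurrence by simp
    also have "\<dots> \<le> r * (e / 2 + r ^ k * x N) + (1 - r) * (e / 2)"
      using Suc.IH r b_less[of "k + N"] by (intro add_mono mult_left_mono) auto
    finally show ?case
      by (simp add: field_simps)
  qed (use \<open>0 < e\<close> in simp)
  have "(\<lambda>k. r ^ k * x N) \<longlonglongrightarrow> 0"
    using r by (intro tendsto_mult_left_zero LIMSEQ_power_zero) auto
  then have "\<forall>\<^sub>F k in sequentially. r ^ k * x N < e / 2"
    using \<open>0 < e\<close> by (intro order_tendstoD(2)) auto
  then have "\<forall>\<^sub>F k in sequentially. x (k + N) < e"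
  proof eventually_elim
    case (elim k)
    then show ?case using bound[of k] by linarith
  qed
  then show "\<forall>\<^sub>F k in sequentially. x k < e"
    by (rule eventually_sequentially_seg[THEN iffD1])
next
  fix a :: real assume "a < 0"
  then show "\<forall>\<^sub>F k in sequentially. a < x k"
    using nonneg by (intro always_eventually allI) (rule less_le_trans)
qed

lemma norm_vector_smult: "norm (c *s v) = norm c * norm (v :: 'a::real_normed_div_algebra^'n)"
  by (simp add: norm_vec_def norm_mult L2_set_right_distrib)

definition vanishing_powers :: "'a::real_normed_field^'n^'n \<Rightarrow> bool" where
  "vanishing_powers M \<longleftrightarrow> (\<forall>v. (\<lambda>k. ((*v) M ^^ k) v) \<longlonglongrightarrow> 0)"

lemma vanishing_powersD: "vanishing_powers M \<Longrightarrow> (\<lambda>k. ((*v) M ^^ k) v) \<longlonglongrightarrow> 0"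
  by (simp add: vanishing_powers_def)

lemma vanishing_powers_of_eigenvalues:
  fixes M :: "complex^'n^'n"
  assumes "\<And>l. l \<in> eigenvalues M \<Longrightarrow> cmod l < 1"
  shows "vanishing_powers M"
  unfolding vanishing_powers_def
proof
  fix v
  show "(\<lambda>k. ((*v) M ^^ k) v) \<longlonglongrightarrow> 0"
  proof (induction v rule: eigenvalue_induct[of _ M])
    case zero
    have "((*v) M ^^ k) 0 = 0" for k
      by (induction k) simp_all
    then show ?case by simp
  next
    case (eigenvalue l v)
    have "((*v) M ^^ k) (M *v v - l *s v) = ((*v) M ^^ Suc k) v - l *s ((*v) M ^^ k) v" for k
      by (induction k) (simp_all add: matrix_vector_mult_diff_distrib vec.scale)
    then have "((*v) M ^^ Suc k) v = l *s ((*v) M ^^ k) v + ((*v) M ^^ k) (M *v v - l *s v)" for k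
      by simp
    then have "norm (((*v) M ^^ Suc k) v)
        \<le> cmod l * norm (((*v) M ^^ k) v) + norm (((*v) M ^^ k) (M *v v - l *s v))" for k
      using norm_triangle_ineq[of "l *s ((*v) M ^^ k) v"] by (simp only: norm_vector_smult)
    moreover have "(\<lambda>k. norm (((*v) M ^^ k) (M *v v - l *s v))) \<longlonglongrightarrow> 0"
      using eigenvalue.IH by (rule tendsto_norm_zero)
    ultimately have "(\<lambda>k. norm (((*v) M ^^ k) v)) \<longlonglongrightarrow> 0"
      by (rule tendsto_0_contractive_recurrence[OF norm_ge_zero assms[OF eigenvalue.hyps] norm_ge_zero])
    then show ?case
      by (rule tendsto_norm_zero_cancel)
  qed
qed

lemma vanishing_powers_complexifyD:
  fixes F :: "real^'n^'n"
  assumes "vanishing_powers (complexify F)"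
  shows "vanishing_powers F"
  unfolding vanishing_powers_def
proof (intro allI vec_tendstoI)
  fix x :: "real^'n" and i
  define v where "v = (\<chi> i. complex_of_real (x $ i))"
  have "((*v) (complexify F) ^^ k) v = (\<chi> i. complex_of_real (((*v) F ^^ k) x $ i))" for k
    by (induction k) (simp_all add: v_def complexify_def matrix_vector_mult_def vec_eq_iff)
  then have "(\<lambda>k. complex_of_real (((*v) F ^^ k) x $ i)) \<longlonglongrightarrow> complex_of_real 0"
    using tendsto_vec_nth[OF vanishing_powersD[OF assms, of v], of i] by simp
  then show "(\<lambda>k. ((*v) F ^^ k) x $ i) \<longlonglongrightarrow> 0 $ i"
    by (simp only: tendsto_of_real_iff zero_index)
qed

lemma vanishing_powers_of_spec_radius: "spec_radius F < 1 \<Longrightarrow> vanishing_powers F"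
  by (intro vanishing_powers_complexifyD vanishing_powers_of_eigenvalues)
    (simp add: spec_radius_less_iff)

lemma funpow_scaleR_matrix:
  fixes F :: "real^'n^'n"
  shows "((*v) (c *\<^sub>R F) ^^ k) x = c ^ k *\<^sub>R ((*v) F ^^ k) x"
  by (induction k) (simp_all add: matrix_vector_mult_scaleR flip: scaleR_matrix_vector_assoc)

lemma vanishing_powers_scaleR:
  fixes F :: "real^'n^'n"
  assumes "vanishing_powers F" "\<bar>c\<bar> \<le> 1"
  shows "vanishing_powers (c *\<^sub>R F)"
  unfolding vanishing_powers_def
proof
  fix x
  have "norm (((*v) (c *\<^sub>R F) ^^ k) x) \<le> norm (((*v) F ^^ k) x)" for k
    using assms(2) by (simp add: funpow_scaleR_matrix power_abs mult_left_le_one_le power_le_one)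
  then show "(\<lambda>k. ((*v) (c *\<^sub>R F) ^^ k) x) \<longlonglongrightarrow> 0"
    by (intro Lim_null_comparison[OF _ tendsto_norm_zero[OF vanishing_powersD[OF assms(1), of x]]]
        always_eventually allI)
qed

section \<open>Quadratic forms and congruence\<close>

lemma matrix_eqI_inner:
  fixes X Y :: "real^'c^'r"
  assumes "\<And>x y. x \<bullet> (X *v y) = x \<bullet> (Y *v y)"
  shows "X = Y"
  by (metis assms matrix_eq vector_eq_ldot)

lemma linear_transpose: "linear (transpose :: real^'c^'r \<Rightarrow> real^'r^'c)"
  by (intro linearI) (simp_all add: transpose_def vec_eq_iff)

lemma inner_transpose_matrix:
  fixes F :: "real^'c^'r"
  shows "x \<bullet> (transpose F *v y) = (F *v x) \<bullet> y"
  by (metis dot_lmul_matrix vector_transpose_matrix)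

lemma bounded_bilinear_matrix_vector_mult:
  "bounded_bilinear ((*v) :: real^'c^'r \<Rightarrow> real^'c \<Rightarrow> real^'r)"
  unfolding bilinear_conv_bounded_bilinear[symmetric] bilinear_def
  by (auto intro!: linearI simp: algebra_simps simp flip: scaleR_matrix_vector_assoc)

lemma bounded_bilinear_matrix_matrix_mult:
  "bounded_bilinear ((**) :: real^'k^'r \<Rightarrow> real^'c^'k \<Rightarrow> real^'c^'r)"
  unfolding bilinear_conv_bounded_bilinear[symmetric] bilinear_def
  by (auto intro!: linearI simp: matrix_add_ldistrib matrix_add_rdistrib matrix_scalar_ac
      scalar_matrix_assoc)

lemmas tendsto_matrix_vector_mult [tendsto_intros] =
  bounded_bilinear.tendsto[OF bounded_bilinear_matrix_vector_mult]

lemmas tendsto_matrix_matrix_mult [tendsto_intros] =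
  bounded_bilinear.tendsto[OF bounded_bilinear_matrix_matrix_mult]

lemmas tendsto_transpose [tendsto_intros] =
  bounded_linear.tendsto[OF linear_conv_bounded_linear[THEN iffD1, OF linear_transpose]]

definition quad_form :: "real^'n^'n \<Rightarrow> real^'n \<Rightarrow> real" where
  "quad_form X x = x \<bullet> (X *v x)"

lemma quad_form_add: "quad_form (X + Y) x = quad_form X x + quad_form Y x"
  by (simp add: quad_form_def matrix_vector_mult_add_rdistrib inner_add_right)

lemma quad_form_diff: "quad_form (X - Y) x = quad_form X x - quad_form Y x"
  by (simp add: quad_form_def matrix_vector_mult_diff_rdistrib inner_diff_right)

lemma quad_form_scaleR: "quad_form (c *\<^sub>R X) x = c * quad_form X x"
  by (simp add: quad_form_def flip: scaleR_matrix_vector_assoc)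

lemma quad_form_scaleR_vector: "quad_form X (c *\<^sub>R x) = c\<^sup>2 * quad_form X x"
  by (simp add: quad_form_def matrix_vector_mult_scaleR power2_eq_square)

lemma tendsto_quad_form [tendsto_intros]:
  "(f \<longlongrightarrow> x) net \<Longrightarrow> ((\<lambda>i. quad_form X (f i)) \<longlongrightarrow> quad_form X x) net"
  unfolding quad_form_def by (intro tendsto_intros)

definition congruence :: "real^'c^'r \<Rightarrow> real^'r^'r \<Rightarrow> real^'c^'c" where
  "congruence F X = transpose F ** X ** F"

lemma inner_congruence: "x \<bullet> (congruence F X *v y) = (F *v x) \<bullet> (X *v (F *v y))"
proof -
  have "congruence F X *v y = transpose F *v (X *v (F *v y))"
    by (simp only: congruence_def matrix_vector_mul_assoc matrix_mul_assoc)
  then show ?thesis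
    by (simp only: inner_transpose_matrix)
qed

lemma quad_form_congruence: "quad_form (congruence F X) x = quad_form X (F *v x)"
  by (simp add: quad_form_def inner_congruence)

lemma linear_congruence: "linear (congruence F)"
  by (intro linearI; rule matrix_eqI_inner)
    (simp_all add: inner_congruence matrix_vector_mult_add_rdistrib inner_add_right
      flip: scaleR_matrix_vector_assoc)

lemma transpose_congruence: "transpose (congruence F X) = congruence F (transpose X)"
  by (simp add: congruence_def matrix_transpose_mul matrix_mul_assoc)

lemma symmetric_matrix_inner_commute: "symmetric_matrix X \<Longrightarrow> x \<bullet> (X *v y) = y \<bullet> (X *v x)"
  by (metis inner_transpose_matrix inner_commute symmetric_matrix_def)

lemma symmetric_matrix_add:
  "symmetric_matrix X \<Longrightarrow> symmetric_matrix Y \<Longrightarrow> symmetric_matrix (X + Y)"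
  by (simp add: symmetric_matrix_def linear_add[OF linear_transpose])

lemma symmetric_matrix_diff:
  "symmetric_matrix X \<Longrightarrow> symmetric_matrix Y \<Longrightarrow> symmetric_matrix (X - Y)"
  by (simp add: symmetric_matrix_def linear_diff[OF linear_transpose])

lemma symmetric_matrix_congruence: "symmetric_matrix X \<Longrightarrow> symmetric_matrix (congruence F X)"
  by (simp add: symmetric_matrix_def transpose_congruence)

lemma pos_def_iff_quad_form:
  "pos_def X \<longleftrightarrow> symmetric_matrix X \<and> (\<forall>x. x \<noteq> 0 \<longrightarrow> 0 < quad_form X x)"
  by (simp add: pos_def_def quad_form_def)

lemma pos_semidef_iff_quad_form:
  "pos_semidef X \<longleftrightarrow> symmetric_matrix X \<and> (\<forall>x. 0 \<le> quad_form X x)"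
  by (simp add: pos_semidef_def quad_form_def)

lemma loewner_le_iff_quad_form:
  assumes "symmetric_matrix X" "symmetric_matrix Y"
  shows "loewner_le X Y \<longleftrightarrow> (\<forall>x. quad_form X x \<le> quad_form Y x)"
  using assms
  by (simp add: loewner_le_def pos_semidef_iff_quad_form symmetric_matrix_diff quad_form_diff)

lemma pos_def_mat_1: "pos_def (mat 1)"
  by (simp add: pos_def_def symmetric_matrix_def)

lemma pos_def_imp_pos_semidef: "pos_def X \<Longrightarrow> pos_semidef X"
  unfolding pos_def_iff_quad_form pos_semidef_iff_quad_form
  by (metis inner_zero_left less_eq_real_def quad_form_def)

lemma pos_semidef_scaleR: "0 \<le> c \<Longrightarrow> pos_semidef X \<Longrightarrow> pos_semidef (c *\<^sub>R X)"
  by (simp add: pos_semidef_iff_quad_form quad_form_scaleR symmetric_matrix_def transpose_scalar)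

lemma pos_semidef_congruence: "pos_semidef X \<Longrightarrow> pos_semidef (congruence F X)"
  by (simp add: pos_semidef_iff_quad_form quad_form_congruence symmetric_matrix_congruence)

lemma pos_def_add_pos_semidef: "pos_def X \<Longrightarrow> pos_semidef Y \<Longrightarrow> pos_def (X + Y)"
  by (simp add: pos_def_iff_quad_form pos_semidef_iff_quad_form quad_form_add add_pos_nonneg
      symmetric_matrix_add)

lemma pos_def_imp_invertible:
  fixes X :: "real^'n^'n"
  assumes "pos_def X"
  shows "invertible X"
proof -
  have "x = 0" if "X *v x = 0" for x
    using assms that unfolding pos_def_def by (metis inner_zero_right less_irrefl)
  then show ?thesis
    by (simp add: invertible_left_inverse matrix_left_invertible_ker)
qed

lemma pos_def_coercive:
  fixes X :: "real^'n^'n"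
  assumes "pos_def X"
  obtains c where "0 < c" "\<And>x. c * (norm x)\<^sup>2 \<le> quad_form X x"
proof -
  have "continuous_on (sphere 0 1) (quad_form X)"
    unfolding continuous_on_def by (intro ballI tendsto_intros)
  moreover have "sphere (0 :: real^'n) 1 \<noteq> {}"
    by simp
  ultimately obtain u :: "real^'n" where "u \<in> sphere 0 1"
    and minimal: "\<And>x. x \<in> sphere 0 1 \<Longrightarrow> quad_form X u \<le> quad_form X x"
    using continuous_attains_inf[OF compact_sphere] by metis
  then have "u \<noteq> 0"
    by auto
  show ?thesis
  proof
    show "0 < quad_form X u"
      using assms \<open>u \<noteq> 0\<close> by (simp add: pos_def_iff_quad_form)
    fix x
    show "quad_form X u * (norm x)\<^sup>2 \<le> quad_form X x"
    proof (cases "x = 0")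
      case False
      then have "quad_form X u * (norm x)\<^sup>2 \<le> quad_form X (x /\<^sub>R norm x) * (norm x)\<^sup>2"
        using minimal by (intro mult_right_mono) auto
      also have "\<dots> = quad_form X x"
        using False by (simp add: quad_form_scaleR_vector power_inverse)
      finally show ?thesis .
    qed (simp add: quad_form_def)
  qed
qed

lemma eventually_pos_def:
  fixes Y :: "real^'n^'n"
  assumes lim: "(X \<longlongrightarrow> Y) net" and "pos_def Y" and symmetric: "\<And>i. symmetric_matrix (X i)"
  shows "\<forall>\<^sub>F i in net. pos_def (X i)"
proof -
  obtain c where "0 < c" and coercive: "\<And>x. c * (norm x)\<^sup>2 \<le> quad_form Y x"
    using pos_def_coercive[OF \<open>pos_def Y\<close>] by blast
  obtain C where bound: "\<And>(Z :: real^'n^'n) (x :: real^'n). norm (Z *v x) \<le> norm Z * norm x * C"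
    using bounded_bilinear.bounded[OF bounded_bilinear_matrix_vector_mult] by blast
  have "((\<lambda>i. norm (Y - X i) * C) \<longlongrightarrow> norm (Y - Y) * C) net"
    by (intro tendsto_intros lim)
  then have "\<forall>\<^sub>F i in net. norm (Y - X i) * C < c"
    using \<open>0 < c\<close> by (auto dest: order_tendstoD(2))
  then show ?thesis
  proof eventually_elim
    case (elim i)
    have "0 < quad_form (X i) x" if "x \<noteq> 0" for x
    proof -
      have "quad_form (Y - X i) x \<le> norm x * (norm (Y - X i) * norm x * C)"
        unfolding quad_form_def
        by (intro order_trans[OF norm_cauchy_schwarz] mult_left_mono bound) simp
      also have "\<dots> = norm (Y - X i) * C * (norm x)\<^sup>2"
        by (simp add: power2_eq_square)
      also have "\<dots> < c * (norm x)\<^sup>2"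
        using elim that by (intro mult_strict_right_mono) auto
      finally show ?thesis
        using coercive[of x] by (simp add: quad_form_diff)
    qed
    with symmetric show ?case
      by (simp add: pos_def_iff_quad_form)
  qed
qed

section \<open>The Stein equation\<close>

definition stein_solution :: "real^'n^'n \<Rightarrow> real^'n^'n \<Rightarrow> real^'n^'n \<Rightarrow> bool" where
  "stein_solution F W P \<longleftrightarrow> congruence F P + W = P"

lemma inner_funpow_congruence:
  fixes F :: "real^'n^'n"
  shows "x \<bullet> ((congruence F ^^ k) X *v y) = (((*v) F ^^ k) x) \<bullet> (X *v ((*v) F ^^ k) y)"
proof (induction k arbitrary: X)
  case (Suc k)
  have "(congruence F ^^ Suc k) X = (congruence F ^^ k) (congruence F X)"
    by (simp only: funpow_Suc_right o_apply)
  then show ?case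
    by (simp add: Suc.IH inner_congruence)
qed simp

lemma congruence_fixed_point_eq_0:
  assumes vanishing: "vanishing_powers F" and fixed: "congruence F X = X"
  shows "X = 0"
proof (rule matrix_eqI_inner)
  fix x y
  have "(\<lambda>k. x \<bullet> ((congruence F ^^ k) X *v y)) \<longlonglongrightarrow> 0 \<bullet> (X *v 0)"
    unfolding inner_funpow_congruence by (intro tendsto_intros vanishing_powersD[OF vanishing])
  moreover have "(congruence F ^^ k) X = X" for k
    by (induction k) (simp_all add: fixed)
  ultimately show "x \<bullet> (X *v y) = x \<bullet> (0 *v y)"
    by (simp add: LIMSEQ_const_iff)
qed

lemma stein_solution_unique:
  assumes "vanishing_powers F" "stein_solution F W P" "stein_solution F W P'"
  shows "P = P'"
proof -
  have "congruence F P = P - W" "congruence F P' = P' - W"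
    using assms(2,3) by (simp_all add: stein_solution_def eq_diff_eq)
  then have "congruence F (P - P') = P - P'"
    by (simp add: linear_diff[OF linear_congruence])
  then show ?thesis
    using congruence_fixed_point_eq_0[OF assms(1)] by force
qed

lemma stein_solution_exists:
  assumes "vanishing_powers F"
  obtains P where "stein_solution F W P"
proof -
  have linear: "linear (\<lambda>X. X - congruence F X)"
    by (intro linear_compose_sub linear_ident linear_congruence)
  moreover have "inj (\<lambda>X. X - congruence F X)"
    unfolding linear_injective_0[OF linear] using congruence_fixed_point_eq_0[OF assms] by force
  ultimately have "surj (\<lambda>X. X - congruence F X)"
    by (rule linear_injective_imp_surjective) (rule refl)
  then obtain P where "P - congruence F P = W"
    by (metis surjD)
  then have "stein_solution F W P"
    by (auto simp: stein_solution_def)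
  then show ?thesis ..
qed

lemma stein_solution_symmetric:
  assumes vanishing: "vanishing_powers F" and solution: "stein_solution F W P"
    and symmetric: "symmetric_matrix W"
  shows "symmetric_matrix P"
proof -
  have "transpose (congruence F P + W) = transpose P"
    using solution by (simp add: stein_solution_def)
  then have "stein_solution F W (transpose P)"
    using symmetric by (simp add: stein_solution_def symmetric_matrix_def transpose_congruence
        linear_add[OF linear_transpose])
  then show ?thesis
    using stein_solution_unique[OF vanishing] solution by (simp add: symmetric_matrix_def)
qed

lemma stein_solution_sums:
  assumes vanishing: "vanishing_powers F" and solution: "stein_solution F W P"
  shows "(\<lambda>k. quad_form W (((*v) F ^^ k) x)) sums quad_form P x"
proof -
  have "(\<lambda>k. quad_form P (((*v) F ^^ k) x)) \<longlonglongrightarrow> quad_form P 0"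
    by (intro tendsto_intros vanishing_powersD[OF vanishing])
  then have "(\<lambda>k. quad_form P (((*v) F ^^ k) x) - quad_form P (((*v) F ^^ Suc k) x))
      sums (quad_form P x - quad_form P 0)"
    using telescope_sums' by fastforce
  moreover have "quad_form P y - quad_form P (F *v y) = quad_form W y" for y
    using arg_cong[OF solution[unfolded stein_solution_def], of "\<lambda>X. quad_form X y"]
    by (simp add: quad_form_add quad_form_congruence)
  ultimately show ?thesis
    by (simp add: quad_form_def)
qed

lemma stein_solution_pos_semidef:
  assumes vanishing: "vanishing_powers F" and solution: "stein_solution F W P" and "pos_semidef W"
  shows "pos_semidef P"
  using stein_solution_symmetric[OF vanishing solution] \<open>pos_semidef W\<close>
    sums_le[OF _ sums_zero stein_solution_sums[OF vanishing solution]]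
  by (auto simp: pos_semidef_iff_quad_form)

lemma stein_solution_pos_def:
  assumes vanishing: "vanishing_powers F" and solution: "stein_solution F W P" and "pos_def W"
  shows "pos_def P"
proof -
  have "pos_semidef (congruence F P)"
    using stein_solution_pos_semidef[OF vanishing solution] \<open>pos_def W\<close>
    by (simp add: pos_def_imp_pos_semidef pos_semidef_congruence)
  then have "pos_def (W + congruence F P)"
    by (rule pos_def_add_pos_semidef[OF \<open>pos_def W\<close>])
  then show ?thesis
    using solution by (simp add: stein_solution_def add.commute)
qed

lemma stein_supersolution_ge:
  assumes vanishing: "vanishing_powers F" and solution: "stein_solution F W P"
    and supersolution: "loewner_le (congruence F X + W) X"
  shows "loewner_le P X"
proof -
  have "congruence F P = P - W"
    using solution by (simp add: stein_solution_def eq_diff_eq)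
  then have "stein_solution F (X - (congruence F X + W)) (X - P)"
    by (simp add: stein_solution_def linear_diff[OF linear_congruence])
  then show ?thesis
    using supersolution stein_solution_pos_semidef[OF vanishing] by (simp add: loewner_le_def)
qed

section \<open>Stability is an open condition\<close>

lemma eigenvalues_complexify_realE:
  assumes "l \<in> eigenvalues (complexify F)"
  obtains a b where "a \<noteq> 0 \<or> b \<noteq> 0"
    "F *v a = Re l *\<^sub>R a - Im l *\<^sub>R b" "F *v b = Im l *\<^sub>R a + Re l *\<^sub>R b"
proof -
  obtain v where "v \<noteq> 0" and eigenvector: "complexify F *v v = l *s v"
    using assms by (auto simp: eigenvalues_def)
  have row: "(\<Sum>j\<in>UNIV. complex_of_real (F $ i $ j) * v $ j) = l * v $ i" for i
    using eigenvector by (simp add: vec_eq_iff complexify_def matrix_vector_mult_def)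
  show ?thesis
  proof (rule that[of "\<chi> i. Re (v $ i)" "\<chi> i. Im (v $ i)"])
    show "(\<chi> i. Re (v $ i)) \<noteq> 0 \<or> (\<chi> i. Im (v $ i)) \<noteq> 0"
      using \<open>v \<noteq> 0\<close> by (auto simp: vec_eq_iff complex_eq_iff)
  qed (use arg_cong[OF row, of Re] arg_cong[OF row, of Im] in
      \<open>simp_all add: vec_eq_iff matrix_vector_mult_def algebra_simps\<close>)
qed

lemma spec_radius_less_one_of_pos_def:
  assumes "pos_def P" and decrease: "pos_def (P - congruence F P)"
  shows "spec_radius F < 1"
  unfolding spec_radius_less_iff
proof
  fix l assume "l \<in> eigenvalues (complexify F)"
  then obtain a b where nonzero: "a \<noteq> 0 \<or> b \<noteq> 0"
    and F: "F *v a = Re l *\<^sub>R a - Im l *\<^sub>R b" "F *v b = Im l *\<^sub>R a + Re l *\<^sub>R b"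
    by (rule eigenvalues_complexify_realE)
  have sum_pos: "0 < quad_form X a + quad_form X b" if "pos_def X" for X
    using nonzero that pos_def_imp_pos_semidef[OF that]
    by (auto simp: pos_def_iff_quad_form pos_semidef_iff_quad_form intro: add_pos_nonneg add_nonneg_pos)
  have "quad_form P (F *v a) + quad_form P (F *v b) = (cmod l)\<^sup>2 * (quad_form P a + quad_form P b)"
    unfolding F cmod_power2 quad_form_def
    by (simp add: matrix_vector_right_distrib matrix_vector_mult_diff_distrib matrix_vector_mult_scaleR
        inner_simps power2_eq_square algebra_simps)
  then have "(cmod l)\<^sup>2 * (quad_form P a + quad_form P b) < 1 * (quad_form P a + quad_form P b)"
    using sum_pos[OF decrease] by (simp add: quad_form_diff quad_form_congruence)
  then have "(cmod l)\<^sup>2 < 1"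
    using sum_pos[OF \<open>pos_def P\<close>] by (simp only: mult_less_cancel_right_pos)
  then show "cmod l < 1"
    by (simp add: abs_square_less_1)
qed

lemma eventually_spec_radius_less_one:
  assumes lim: "(G \<longlongrightarrow> F) net" and "spec_radius F < 1"
  shows "\<forall>\<^sub>F i in net. spec_radius (G i) < 1"
proof -
  have vanishing: "vanishing_powers F"
    using \<open>spec_radius F < 1\<close> by (rule vanishing_powers_of_spec_radius)
  then obtain P where solution: "stein_solution F (mat 1) P"
    by (rule stein_solution_exists)
  then have "pos_def P"
    using stein_solution_pos_def[OF vanishing] pos_def_mat_1 by blast
  have "((\<lambda>i. P - congruence (G i) P) \<longlongrightarrow> P - congruence F P) net"
    unfolding congruence_def by (intro tendsto_intros lim)
  moreover have "P - congruence F P = mat 1"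
    using solution by (simp add: stein_solution_def algebra_simps)
  ultimately have "\<forall>\<^sub>F i in net. pos_def (P - congruence (G i) P)"
    using \<open>pos_def P\<close> pos_def_mat_1
    by (elim eventually_pos_def) (simp_all add: pos_def_def symmetric_matrix_diff symmetric_matrix_congruence)
  then show ?thesis
    by eventually_elim (rule spec_radius_less_one_of_pos_def[OF \<open>pos_def P\<close>])
qed

section \<open>Policy evaluation\<close>

definition discounted_closed_loop :: "real^'n^'n \<Rightarrow> real^'m^'n \<Rightarrow> real \<Rightarrow> real^'n^'m \<Rightarrow> real^'n^'n" where
  "discounted_closed_loop A B \<gamma> K = sqrt \<gamma> *\<^sub>R (A + B ** K)"

definition stage_cost :: "real^'n^'n \<Rightarrow> real^'m^'m \<Rightarrow> real^'n^'m \<Rightarrow> real^'n^'n" where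
  "stage_cost Q R K = congruence K R + Q"

lemma pos_def_stage_cost: "pos_def Q \<Longrightarrow> pos_semidef R \<Longrightarrow> pos_def (stage_cost Q R K)"
  unfolding stage_cost_def add.commute[of _ Q]
  by (intro pos_def_add_pos_semidef pos_semidef_congruence)

lemma vanishing_powers_discounted_closed_loop:
  assumes "K \<in> stabilizing_gains A B" "0 \<le> \<gamma>" "\<gamma> \<le> 1"
  shows "vanishing_powers (discounted_closed_loop A B \<gamma> K)"
  unfolding discounted_closed_loop_def using assms
  by (intro vanishing_powers_scaleR vanishing_powers_of_spec_radius) (simp_all add: stabilizing_gains_def)

lemma lyapunov_solution_iff_stein_solution:
  "lyapunov_solution A B Q R \<gamma> K P \<longleftrightarrow>
     stein_solution (discounted_closed_loop A B \<gamma> K) (stage_cost Q R K) P"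
  by (simp add: lyapunov_solution_def stein_solution_def discounted_closed_loop_def stage_cost_def
      congruence_def transpose_scalar) (simp add: algebra_simps)

lemma lyapunov_solution_exists:
  assumes "K \<in> stabilizing_gains A B" "0 \<le> \<gamma>" "\<gamma> \<le> 1"
  obtains P where "lyapunov_solution A B Q R \<gamma> K P"
  unfolding lyapunov_solution_iff_stein_solution
  by (rule stein_solution_exists[OF vanishing_powers_discounted_closed_loop[OF assms]])

lemma lyapunov_solution_pos_def:
  assumes stabilizing: "K \<in> stabilizing_gains A B" and discount: "0 \<le> \<gamma>" "\<gamma> \<le> 1"
    and weights: "pos_def Q" "pos_def R" and solution: "lyapunov_solution A B Q R \<gamma> K P"
  shows "pos_def P"
  using vanishing_powers_discounted_closed_loop[OF stabilizing discount]
    solution[unfolded lyapunov_solution_iff_stein_solution]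
  by (rule stein_solution_pos_def) (simp add: weights pos_def_stage_cost pos_def_imp_pos_semidef)

lemma closed_loop_state_eq_funpow:
  "closed_loop_state A B K x k = ((*v) (A + B ** K) ^^ k) x"
  by (induction k) (simp_all add: matrix_vector_mult_add_rdistrib matrix_vector_mul_assoc)

lemma discounted_cost_eq_quad_form:
  assumes stabilizing: "K \<in> stabilizing_gains A B" and discount: "0 \<le> \<gamma>" "\<gamma> \<le> 1"
    and solution: "lyapunov_solution A B Q R \<gamma> K P"
  shows "discounted_cost A B Q R \<gamma> x K = quad_form P x"
proof -
  have "\<gamma> ^ k * (let y = closed_loop_state A B K x k; u = K *v y in y \<bullet> (Q *v y) + u \<bullet> (R *v u))
      = quad_form (stage_cost Q R K) (((*v) (discounted_closed_loop A B \<gamma> K) ^^ k) x)" for k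
  proof -
    define y where "y = closed_loop_state A B K x k"
    have "((*v) (discounted_closed_loop A B \<gamma> K) ^^ k) x = sqrt \<gamma> ^ k *\<^sub>R y"
      by (simp add: discounted_closed_loop_def funpow_scaleR_matrix y_def closed_loop_state_eq_funpow)
    moreover have "(sqrt \<gamma> ^ k)\<^sup>2 = \<gamma> ^ k"
      using discount(1) by (metis power_mult real_sqrt_pow2 mult.commute)
    ultimately show ?thesis
      unfolding y_def[symmetric] Let_def
      by (simp only: quad_form_scaleR_vector stage_cost_def quad_form_add quad_form_congruence)
        (simp add: quad_form_def)
  qed
  then show ?thesis
    unfolding discounted_cost_def
    using stein_solution_sums[OF vanishing_powers_discounted_closed_loop[OF stabilizing discount]] solution
    by (simp add: lyapunov_solution_iff_stein_solution sums_iff)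
qed

lemma discounted_cost_mono:
  assumes discount: "0 \<le> \<gamma>" "\<gamma> \<le> 1"
    and K: "K \<in> stabilizing_gains A B" "lyapunov_solution A B Q R \<gamma> K P"
    and K': "K' \<in> stabilizing_gains A B" "lyapunov_solution A B Q R \<gamma> K' P'"
    and P'_le_P: "loewner_le P' P"
  shows "discounted_cost A B Q R \<gamma> x K' \<le> discounted_cost A B Q R \<gamma> x K"
  unfolding discounted_cost_eq_quad_form[OF K(1) discount K(2)]
    discounted_cost_eq_quad_form[OF K'(1) discount K'(2)]
  using P'_le_P by (simp add: loewner_le_def pos_semidef_iff_quad_form quad_form_diff)

section \<open>Policy improvement\<close>

definition cost_to_go ::
  "real^'n^'n \<Rightarrow> real^'m^'n \<Rightarrow> real^'n^'n \<Rightarrow> real^'m^'m \<Rightarrow> real \<Rightarrow> real^'n^'n \<Rightarrow> real^'n \<Rightarrow> real^'m \<Rightarrow> real" where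
  "cost_to_go A B Q R \<gamma> P x u = quad_form Q x + quad_form R u + \<gamma> * quad_form P (A *v x + B *v u)"

lemma cost_to_go_policy:
  assumes "0 \<le> \<gamma>"
  shows "cost_to_go A B Q R \<gamma> P x (K *v x)
    = quad_form (congruence (discounted_closed_loop A B \<gamma> K) P + stage_cost Q R K) x"
proof -
  have "discounted_closed_loop A B \<gamma> K *v x = sqrt \<gamma> *\<^sub>R (A *v x + B *v (K *v x))"
    by (simp add: discounted_closed_loop_def matrix_vector_mult_add_rdistrib matrix_vector_mul_assoc
        flip: scaleR_matrix_vector_assoc)
  then show ?thesis
    using assms
    by (simp add: cost_to_go_def stage_cost_def quad_form_add quad_form_congruence quad_form_scaleR_vector)
qed

definition input_weight :: "real^'m^'n \<Rightarrow> real^'m^'m \<Rightarrow> real \<Rightarrow> real^'n^'n \<Rightarrow> real^'m^'m" where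
  "input_weight B R \<gamma> P = R + \<gamma> *\<^sub>R congruence B P"

lemma pos_def_input_weight:
  "pos_def R \<Longrightarrow> 0 \<le> \<gamma> \<Longrightarrow> pos_semidef P \<Longrightarrow> pos_def (input_weight B R \<gamma> P)"
  unfolding input_weight_def
  by (intro pos_def_add_pos_semidef pos_semidef_scaleR pos_semidef_congruence)

definition greedy_gain ::
  "real^'n^'n \<Rightarrow> real^'m^'n \<Rightarrow> real^'m^'m \<Rightarrow> real \<Rightarrow> real^'n^'n \<Rightarrow> real^'n^'m" where
  "greedy_gain A B R \<gamma> P =
     - (\<gamma> *\<^sub>R (matrix_inv (input_weight B R \<gamma> P) ** transpose B ** P ** A))"

lemma improved_gain_eq: "improved_gain A B R \<gamma> P \<alpha> K = \<alpha> *\<^sub>R greedy_gain A B R \<gamma> P + (1 - \<alpha>) *\<^sub>R K"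
  by (simp add: improved_gain_def greedy_gain_def input_weight_def congruence_def)

lemma quad_form_complete_square:
  assumes symmetric: "symmetric_matrix S" and stationary: "S *v w = - b"
  shows "quad_form S u + 2 * (u \<bullet> b) = quad_form S w + 2 * (w \<bullet> b) + quad_form S (u - w)"
proof -
  have b: "b = - (S *v w)"
    by (simp add: stationary)
  show ?thesis
    using symmetric_matrix_inner_commute[OF symmetric, of w u]
    by (simp add: b quad_form_def matrix_vector_mult_diff_distrib inner_simps)
qed

lemma matrix_inv_right: "invertible X \<Longrightarrow> X ** matrix_inv X = mat 1"
  unfolding invertible_def matrix_inv_def by (rule someI_ex[THEN conjunct1])

lemma greedy_gain_stationary:
  assumes "invertible (input_weight B R \<gamma> P)"
  shows "input_weight B R \<gamma> P *v (greedy_gain A B R \<gamma> P *v x)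
    = - (\<gamma> *\<^sub>R (transpose B *v (P *v (A *v x))))"
proof -
  let ?S = "input_weight B R \<gamma> P"
  have "?S ** (matrix_inv ?S ** transpose B ** P ** A) = transpose B ** P ** A"
    by (simp add: matrix_inv_right[OF assms] matrix_mul_assoc)
  then have "?S ** greedy_gain A B R \<gamma> P = - (\<gamma> *\<^sub>R (transpose B ** P ** A))"
    unfolding greedy_gain_def scaleR_minus_left[symmetric]
    by (simp only: matrix_scalar_ac flip: scalar_matrix_assoc)
  then show ?thesis
    unfolding matrix_vector_mul_assoc
    by (simp only: flip: scaleR_minus_left scaleR_matrix_vector_assoc matrix_mul_assoc)
qed

lemma cost_to_go_eq_greedy:
  assumes P: "symmetric_matrix P" and S: "pos_def (input_weight B R \<gamma> P)"
  shows "cost_to_go A B Q R \<gamma> P x u = cost_to_go A B Q R \<gamma> P x (greedy_gain A B R \<gamma> P *v x)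
    + quad_form (input_weight B R \<gamma> P) (u - greedy_gain A B R \<gamma> P *v x)"
proof -
  let ?S = "input_weight B R \<gamma> P"
  let ?w = "greedy_gain A B R \<gamma> P *v x"
  define b where "b = \<gamma> *\<^sub>R (transpose B *v (P *v (A *v x)))"
  have inner_b: "v \<bullet> b = \<gamma> * ((B *v v) \<bullet> (P *v (A *v x)))" for v
    unfolding b_def inner_scaleR_right inner_transpose_matrix ..
  have "cost_to_go A B Q R \<gamma> P x v
      = quad_form Q x + \<gamma> * quad_form P (A *v x) + (quad_form ?S v + 2 * (v \<bullet> b))" for v
    using symmetric_matrix_inner_commute[OF P, of "A *v x" "B *v v"]
    unfolding cost_to_go_def inner_b input_weight_def quad_form_add quad_form_scaleR quad_form_congruence
    by (simp add: quad_form_def matrix_vector_right_distrib inner_simps algebra_simps)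
  moreover have "symmetric_matrix ?S" "?S *v ?w = - b"
    using S greedy_gain_stationary[OF pos_def_imp_invertible[OF S]] by (simp_all add: pos_def_def b_def)
  then have "quad_form ?S u + 2 * (u \<bullet> b) = quad_form ?S ?w + 2 * (?w \<bullet> b) + quad_form ?S (u - ?w)"
    by (rule quad_form_complete_square)
  ultimately show ?thesis
    by simp
qed

lemma cost_to_go_improved_gain_le:
  assumes P: "pos_semidef P" and R: "pos_def R" and discount: "0 \<le> \<gamma>" and step_size: "\<alpha> \<in> {0..1}"
  shows "cost_to_go A B Q R \<gamma> P x (improved_gain A B R \<gamma> P \<alpha> K *v x)
    \<le> cost_to_go A B Q R \<gamma> P x (K *v x)"
proof -
  let ?S = "input_weight B R \<gamma> P"
  define w where "w = greedy_gain A B R \<gamma> P *v x"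
  have S: "pos_def ?S"
    by (rule pos_def_input_weight[OF R discount P])
  have excess: "cost_to_go A B Q R \<gamma> P x u = cost_to_go A B Q R \<gamma> P x w + quad_form ?S (u - w)" for u
    unfolding w_def using P by (intro cost_to_go_eq_greedy[OF _ S]) (simp add: pos_semidef_def)
  have "improved_gain A B R \<gamma> P \<alpha> K *v x - w = (1 - \<alpha>) *\<^sub>R (K *v x - w)"
    by (simp add: improved_gain_eq w_def matrix_vector_mult_add_rdistrib algebra_simps
        flip: scaleR_matrix_vector_assoc)
  then have "quad_form ?S (improved_gain A B R \<gamma> P \<alpha> K *v x - w) = (1 - \<alpha>)\<^sup>2 * quad_form ?S (K *v x - w)"
    by (simp only: quad_form_scaleR_vector)
  also have "\<dots> \<le> quad_form ?S (K *v x - w)"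
    using pos_def_imp_pos_semidef[OF S] step_size
    by (intro mult_left_le_one_le) (auto simp: pos_semidef_iff_quad_form power_le_one)
  finally show ?thesis
    using excess[of "K *v x"] excess[of "improved_gain A B R \<gamma> P \<alpha> K *v x"] by linarith
qed

lemma lyapunov_solution_improved_gain_le:
  assumes discount: "0 \<le> \<gamma>" "\<gamma> \<le> 1" and weights: "pos_def Q" "pos_def R"
    and step_size: "\<alpha> \<in> {0..1}" and K'_eq: "K' = improved_gain A B R \<gamma> P \<alpha> K"
    and K: "K \<in> stabilizing_gains A B" "lyapunov_solution A B Q R \<gamma> K P"
    and K': "K' \<in> stabilizing_gains A B" "lyapunov_solution A B Q R \<gamma> K' P'"
  shows "loewner_le P' P"
proof -
  let ?F = "discounted_closed_loop A B \<gamma>"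
  let ?W = "stage_cost Q R"
  have P: "pos_semidef P"
    using lyapunov_solution_pos_def[OF K(1) discount weights K(2)] by (rule pos_def_imp_pos_semidef)
  have "quad_form (congruence (?F K') P + ?W K') x \<le> quad_form P x" for x
  proof -
    have "quad_form (congruence (?F K') P + ?W K') x \<le> quad_form (congruence (?F K) P + ?W K) x"
      unfolding cost_to_go_policy[OF discount(1), symmetric] K'_eq
      by (rule cost_to_go_improved_gain_le[OF P weights(2) discount(1) step_size])
    also have "congruence (?F K) P + ?W K = P"
      using K(2) by (simp add: lyapunov_solution_iff_stein_solution stein_solution_def)
    finally show ?thesis .
  qed
  moreover have "pos_def (?W K')"
    using weights by (intro pos_def_stage_cost pos_def_imp_pos_semidef)
  then have "symmetric_matrix (congruence (?F K') P + ?W K')"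
    using P by (simp add: pos_semidef_def pos_def_def symmetric_matrix_congruence symmetric_matrix_add)
  ultimately have "loewner_le (congruence (?F K') P + ?W K') P"
    using P by (simp add: loewner_le_iff_quad_form pos_semidef_def)
  then show ?thesis
    using K'(2) stein_supersolution_ge[OF vanishing_powers_discounted_closed_loop[OF K'(1) discount]]
    by (simp add: lyapunov_solution_iff_stein_solution)
qed

lemma eventually_improved_gain_stabilizing:
  assumes "K \<in> stabilizing_gains A B"
  shows "\<forall>\<^sub>F \<alpha> in at_right 0. improved_gain A B R \<gamma> P \<alpha> K \<in> stabilizing_gains A B"
proof -
  let ?G = "greedy_gain A B R \<gamma> P"
  have "((\<lambda>\<alpha>. A + B ** (\<alpha> *\<^sub>R ?G + (1 - \<alpha>) *\<^sub>R K)) \<longlongrightarrow> A + B ** (0 *\<^sub>R ?G + (1 - 0) *\<^sub>R K)) (at_right 0)"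
    by (intro tendsto_intros)
  then show ?thesis
    using assms eventually_spec_radius_less_one by (simp add: improved_gain_eq stabilizing_gains_def)
qed

lemma stabilizing_improved_gain_exists:
  assumes "K \<in> stabilizing_gains A B"
  obtains \<alpha> where "\<alpha> \<in> {0<..1}" "improved_gain A B R \<gamma> P \<alpha> K \<in> stabilizing_gains A B"
proof -
  have "\<forall>\<^sub>F \<alpha> in at_right (0::real). \<alpha> \<in> {0<..1}"
    using eventually_at_right_real[of 0 1] by (rule eventually_mono) auto
  then have "\<forall>\<^sub>F \<alpha> in at_right 0. \<alpha> \<in> {0<..1} \<and> improved_gain A B R \<gamma> P \<alpha> K \<in> stabilizing_gains A B"
    using eventually_improved_gain_stabilizing[OF assms] by (rule eventually_conj)
  then show ?thesis
    using that eventually_happens'[OF trivial_limit_at_right_real] by blast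
qed

section \<open>Soundness of the iteration\<close>

lemma sPI_run_stabilizing:
  assumes "sPI_run A B Q R \<gamma> K0 N \<alpha> K P" "K0 \<in> stabilizing_gains A B" "j \<le> N"
  shows "K j \<in> stabilizing_gains A B" "lyapunov_solution A B Q R \<gamma> (K j) (P j)"
  using assms by (cases "j = 0"; auto simp: sPI_run_def)+

lemma sPI_step_feasible:
  assumes discount: "0 \<le> \<gamma>" "\<gamma> \<le> 1" and weights: "pos_def Q" "pos_def R"
    and K: "K \<in> stabilizing_gains A B"
  shows "\<exists>\<alpha>\<in>{0<..1}. \<exists>K'\<in>stabilizing_gains A B. \<exists>P'. symmetric_matrix P' \<and>
    K' = improved_gain A B R \<gamma> P \<alpha> K \<and> lyapunov_solution A B Q R \<gamma> K' P'"
proof -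
  obtain \<alpha> where "\<alpha> \<in> {0<..1}" and K': "improved_gain A B R \<gamma> P \<alpha> K \<in> stabilizing_gains A B"
    by (rule stabilizing_improved_gain_exists[OF K])
  moreover obtain P' where P': "lyapunov_solution A B Q R \<gamma> (improved_gain A B R \<gamma> P \<alpha> K) P'"
    by (rule lyapunov_solution_exists[OF K' discount])
  moreover have "symmetric_matrix P'"
    using lyapunov_solution_pos_def[OF K' discount weights P'] by (simp add: pos_def_def)
  ultimately show ?thesis
    by blast
qed

theorem theorem5:
  fixes A :: "real^'n^'n" and B :: "real^'m^'n"
    and Q :: "real^'n^'n" and R :: "real^'m^'m"
    and \<gamma> :: real and K0 :: "real^'n^'m"
  assumes "stabilizable A B"
    and "pos_def Q" and "pos_def R"
    and "0 \<le> \<gamma>" and "\<gamma> \<le> 1"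
    and "K0 \<in> stabilizing_gains A B"
  shows "(\<forall>j>0. \<forall>\<alpha> K P. sPI_run A B Q R \<gamma> K0 (j - 1) \<alpha> K P \<longrightarrow>
         (\<exists>\<alpha>j\<in>{0<..1}. \<exists>Kj\<in>stabilizing_gains A B. \<exists>Pj. symmetric_matrix Pj \<and>
            Kj = improved_gain A B R \<gamma> (P (j - 1)) \<alpha>j (K (j - 1)) \<and>
            lyapunov_solution A B Q R \<gamma> Kj Pj))
    \<and> (\<forall>\<alpha> K P. \<forall>j>0. sPI_run A B Q R \<gamma> K0 j \<alpha> K P \<longrightarrow>
         loewner_le (P j) (P (j - 1)) \<and>
         (\<forall>x0. discounted_cost A B Q R \<gamma> x0 (K j) - discounted_cost A B Q R \<gamma> x0 (K (j - 1)) \<le> 0))"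
proof (intro conjI allI impI)
  fix j :: nat and \<alpha> K P
  assume "sPI_run A B Q R \<gamma> K0 (j - 1) \<alpha> K P"
  then have "K (j - 1) \<in> stabilizing_gains A B"
    using sPI_run_stabilizing(1) assms(6) by blast
  then show "\<exists>\<alpha>j\<in>{0<..1}. \<exists>Kj\<in>stabilizing_gains A B. \<exists>Pj. symmetric_matrix Pj \<and>
      Kj = improved_gain A B R \<gamma> (P (j - 1)) \<alpha>j (K (j - 1)) \<and> lyapunov_solution A B Q R \<gamma> Kj Pj"
    by (rule sPI_step_feasible[OF assms(4,5,2,3)])
next
  fix \<alpha> K P and j :: nat
  assume "0 < j" and run: "sPI_run A B Q R \<gamma> K0 j \<alpha> K P"
  then have "\<alpha> j \<in> {0<..1}" and step: "K j = improved_gain A B R \<gamma> (P (j - 1)) (\<alpha> j) (K (j - 1))"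
    by (auto simp: sPI_run_def)
  then have step_size: "\<alpha> j \<in> {0..1}"
    by simp
  note current = sPI_run_stabilizing[OF run assms(6) order_refl]
  note previous = sPI_run_stabilizing[OF run assms(6) diff_le_self, of 1]
  show improvement: "loewner_le (P j) (P (j - 1))"
    by (rule lyapunov_solution_improved_gain_le[OF assms(4,5,2,3) step_size step previous current])
  show "discounted_cost A B Q R \<gamma> x0 (K j) - discounted_cost A B Q R \<gamma> x0 (K (j - 1)) \<le> 0" for x0
    using discounted_cost_mono[OF assms(4,5) previous current improvement] by simp
qed

end
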